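(* Let $D$ be an oriented graph missing $3$ disjoint stars whose centers form a directed triangle in $D$, and let $\Delta$ be the dependency digraph of $D$. If $\Delta$ has neither a source nor a sink and $D$ has no sink, then $D$ has at least two vertices with the second neighborhood property, that is, there are at least two distinct vertices $v\in V(D)$ with $d^+_D(v)\le d^{++}_D(v)$.
   Context: All digraphs are finite. An oriented graph is a digraph without loops and without digons (directed cycles of length two). Write $x\rightarrow y$ if $(x,y)$ is an arc. $N^+(v)$ is the set of out-neighbors of $v$ and $N^{++}(v)$ is the set of vertices at distance exactly $2$ from $v$ (reached from $v$ by a directed path of length 2 but not by one of length 0 or 1); $d^+(v)=|N^+(v)|$, $d^{++}(v)=|N^{++}(v)|$. In any digraph, a sink is a vertex of out-degree $0$ and a source is a vertex of in-degree $0$. For distinct vertices $x,y$ of $D$, $xy$ is a missing edge if neither $(x,y)$ nor $(y,x)$ is an arc of $D$. The missing graph of $D$ is the graph whose edges are the missing edges of $D$ and whose vertices are the vertices of $D$ that are not adjacent to all other vertices. A star of center $x$ is a graph whose edge set has the form $\{a_ix : i=1,\dots,k\}$ with $k\ge 1$, the $a_i$ distinct and different from $x$ (when $k=1$, one of the two endpoints is designated as center). $D$ is missing 3 disjoint stars if its missing graph is the union of three pairwise vertex-disjoint stars. The centers $x,y,z$ of the stars form a directed triangle if the subdigraph of $D$ induced by $\{x,y,z\}$ is a directed cycle of length $3$. Dependency digraph: for missing edges $e$ and $e'$ of $D$, $e$ loses to $e'$ if the endpoints can be named $e=x_1y_1$, $e'=x_2y_2$ so that $x_1\rightarrow x_2$,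 $y_2\notin N^+(x_1)\cup N^{++}(x_1)$, $y_1\rightarrow y_2$ and $x_2\notin N^+(y_1)\cup N^{++}(y_1)$. The dependency digraph $\Delta$ of $D$ has the missing edges of $D$ as vertices, and an arc $(e,e')$ whenever $e$ loses to $e'$ (digons in $\Delta$ are allowed). *)

theory Defs
  imports "Graph_Theory.Digraph" "Graph_Theory.Digraph_Component"
begin

locale oriented_graph = digraph +
  assumes no_digons: "u \<rightarrow>\<^bsub>G\<^esub> v \<Longrightarrow> \<not> v \<rightarrow>\<^bsub>G\<^esub> u"

definition out_nbrs :: "('a, 'b) pre_digraph \<Rightarrow> 'a \<Rightarrow> 'a set" where
  "out_nbrs G v = {w. v \<rightarrow>\<^bsub>G\<^esub> w}"

definition second_out_nbrs :: "('a, 'b) pre_digraph \<Rightarrow> 'a \<Rightarrow> 'a set" where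
  "second_out_nbrs G v =
     {w. w \<noteq> v \<and> \<not> v \<rightarrow>\<^bsub>G\<^esub> w \<and> (\<exists>u. v \<rightarrow>\<^bsub>G\<^esub> u \<and> u \<rightarrow>\<^bsub>G\<^esub> w)}"

definition has_SNP :: "('a, 'b) pre_digraph \<Rightarrow> 'a \<Rightarrow> bool" where
  "has_SNP G v \<longleftrightarrow> card (out_nbrs G v) \<le> card (second_out_nbrs G v)"

definition sink :: "('a, 'b) pre_digraph \<Rightarrow> 'a \<Rightarrow> bool" where
  "sink G v \<longleftrightarrow> v \<in> verts G \<and> out_degree G v = 0"

definition source :: "('a, 'b) pre_digraph \<Rightarrow> 'a \<Rightarrow> bool" where
  "source G v \<longleftrightarrow> v \<in> verts G \<and> in_degree G v = 0"

definition adjacent :: "('a, 'b) pre_digraph \<Rightarrow> 'a \<Rightarrow> 'a \<Rightarrow> bool" where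
  "adjacent G u v \<longleftrightarrow> u \<rightarrow>\<^bsub>G\<^esub> v \<or> v \<rightarrow>\<^bsub>G\<^esub> u"

definition missing_edges :: "('a, 'b) pre_digraph \<Rightarrow> 'a set set" where
  "missing_edges G =
     {{x, y} | x y. x \<in> verts G \<and> y \<in> verts G \<and> x \<noteq> y \<and> \<not> adjacent G x y}"

text \<open>An undirected graph is given by its vertex set and its set of two-element edges.\<close>

type_synonym 'a ugraph = "'a set \<times> 'a set set"

definition missing_graph :: "('a, 'b) pre_digraph \<Rightarrow> 'a ugraph" where
  "missing_graph G =
     ({v \<in> verts G. \<not> (\<forall>w \<in> verts G - {v}. adjacent G v w)}, missing_edges G)"

definition star :: "'a ugraph \<Rightarrow> 'a \<Rightarrow> bool" where
  "star S x \<longleftrightarrow>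
     (\<exists>A. finite A \<and> A \<noteq> {} \<and> x \<notin> A \<and> S = (insert x A, {{a, x} | a. a \<in> A}))"

text \<open>The missing graph is the union of three disjoint stars with respective centers
  \<open>x\<close>, \<open>y\<close>, \<open>z\<close>; either endpoint of a one-edge star may serve as its center.\<close>

definition missing_three_disjoint_stars ::
    "('a, 'b) pre_digraph \<Rightarrow> 'a \<Rightarrow> 'a \<Rightarrow> 'a \<Rightarrow> bool" where
  "missing_three_disjoint_stars G x y z \<longleftrightarrow>
     (\<exists>S T U. star S x \<and> star T y \<and> star U z \<and>
        fst S \<inter> fst T = {} \<and> fst S \<inter> fst U = {} \<and> fst T \<inter> fst U = {} \<and>
        missing_graph G = (fst S \<union> fst T \<union> fst U, snd S \<union> snd T \<union> snd U))"

definition directed_triangle :: "('a, 'b) pre_digraph \<Rightarrow> bool" where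
  "directed_triangle G \<longleftrightarrow>
     (\<exists>a b c. distinct [a, b, c] \<and> verts G = {a, b, c} \<and>
        arcs_ends G = {(a, b), (b, c), (c, a)})"

definition loses_to :: "('a, 'b) pre_digraph \<Rightarrow> 'a set \<Rightarrow> 'a set \<Rightarrow> bool" where
  "loses_to G e e' \<longleftrightarrow>
     (\<exists>x1 y1 x2 y2. e = {x1, y1} \<and> e' = {x2, y2} \<and>
        x1 \<rightarrow>\<^bsub>G\<^esub> x2 \<and> y2 \<notin> out_nbrs G x1 \<union> second_out_nbrs G x1 \<and>
        y1 \<rightarrow>\<^bsub>G\<^esub> y2 \<and> x2 \<notin> out_nbrs G y1 \<union> second_out_nbrs G y1)"

definition dependency_digraph ::
    "('a, 'b) pre_digraph \<Rightarrow> ('a set, 'a set \<times> 'a set) pre_digraph" where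
  "dependency_digraph G =
     \<lparr> verts = missing_edges G,
       arcs = {(e, e'). e \<in> missing_edges G \<and> e' \<in> missing_edges G \<and> loses_to G e e'},
       tail = fst, head = snd \<rparr>"

end

theory Submission
  imports Defs
begin

text \<open>Let \<open>x \<rightarrow> y \<rightarrow> z \<rightarrow> x\<close> be the centres and \<open>A\<close>, \<open>B\<close>, \<open>C\<close> the corresponding sets of leaves.
  A missing edge of the star at \<open>x\<close> can only lose to one at \<open>y\<close>, one at \<open>y\<close> only to one at \<open>z\<close>,
  and one at \<open>z\<close> only to one at \<open>x\<close>. As every missing edge both loses and is lost to, the vertices
  of the missing graph form a module \<open>K\<close> in which \<open>A\<close>, \<open>B\<close>, \<open>C\<close> dominate each other cyclically;
  whichever of \<open>card B \<le> card C\<close> and its two rotations holds yields two vertices with the second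
  neighbourhood property inside \<open>K\<close>. Contracting \<open>K\<close> to a vertex of weight \<open>card K\<close> leaves a weighted
  tournament. If its contracted vertex has the weighted property, then so do the two vertices of
  \<open>K\<close> in the whole graph; otherwise median orders and sedimentation (Havet and Thomasse) give two
  such vertices of weight 1 outside \<open>K\<close>.\<close>

section \<open>Weighted second neighbourhoods of a relation\<close>

definition nbrs :: "'a set \<Rightarrow> ('a \<Rightarrow> 'a \<Rightarrow> bool) \<Rightarrow> 'a \<Rightarrow> 'a set" where
  "nbrs V E u = {v \<in> V. E u v}"

definition nbrs2 :: "'a set \<Rightarrow> ('a \<Rightarrow> 'a \<Rightarrow> bool) \<Rightarrow> 'a \<Rightarrow> 'a set" where
  "nbrs2 V E u = {v \<in> V. v \<noteq> u \<and> \<not> E u v \<and> (\<exists>t \<in> V. E u t \<and> E t v)}"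

definition seymour :: "'a set \<Rightarrow> ('a \<Rightarrow> 'a \<Rightarrow> bool) \<Rightarrow> ('a \<Rightarrow> nat) \<Rightarrow> 'a \<Rightarrow> bool" where
  "seymour V E w u \<longleftrightarrow> sum w (nbrs V E u) \<le> sum w (nbrs2 V E u)"

text \<open>Antisymmetry is global and totality confined to \<open>V\<close>, so one relation
  \<open>E\<close> serves every subset of the vertices.\<close>

definition tournament_on :: "'a set \<Rightarrow> ('a \<Rightarrow> 'a \<Rightarrow> bool) \<Rightarrow> bool" where
  "tournament_on V E \<longleftrightarrow> finite V \<and> (\<forall>u v. E u v \<longrightarrow> \<not> E v u) \<and>
     (\<forall>u \<in> V. \<forall>v \<in> V. u \<noteq> v \<longrightarrow> E u v \<or> E v u)"

section \<open>Weighted median orders\<close>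

context
  fixes E :: "'a \<Rightarrow> 'a \<Rightarrow> bool" and w :: "'a \<Rightarrow> nat"
begin

definition outw :: "'a \<Rightarrow> 'a list \<Rightarrow> nat" where
  "outw v us = (\<Sum>u\<leftarrow>us. if E v u then w u else 0)"

definition inw :: "'a \<Rightarrow> 'a list \<Rightarrow> nat" where
  "inw v us = (\<Sum>u\<leftarrow>us. if E u v then w u else 0)"

text \<open>The weight of the forward arcs of an order, each arc counting the product of the weights
  of its ends. Moving a single \<open>v\<close> then changes the score by a multiple of
  \<open>w v\<close>.\<close>

fun score :: "'a list \<Rightarrow> nat" where
  "score [] = 0"
| "score (v # us) = w v * outw v us + score us"

definition cross :: "'a list \<Rightarrow> 'a list \<Rightarrow> nat" where
  "cross us vs = (\<Sum>u\<leftarrow>us. w u * outw u vs)"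

definition orders :: "'a set \<Rightarrow> 'a list set" where
  "orders V = {xs. distinct xs \<and> set xs = V}"

definition median_order :: "'a set \<Rightarrow> 'a list \<Rightarrow> bool" where
  "median_order V xs \<longleftrightarrow> xs \<in> orders V \<and> (\<forall>ys \<in> orders V. score ys \<le> score xs)"

text \<open>Here \<open>f\<close> is the last (feed) vertex and \<open>us\<close> the order before
  it. In a tournament, an in-neighbour of \<open>f\<close> in \<open>us\<close> that is not bad is
  dominated by some earlier out-neighbour of \<open>f\<close>.\<close>

definition bad :: "'a \<Rightarrow> 'a list \<Rightarrow> 'a \<Rightarrow> bool" where
  "bad f us u \<longleftrightarrow> E u f \<and> (\<forall>v \<in> set (takeWhile (\<lambda>v. v \<noteq> u) us). E f v \<longrightarrow> E u v)"

definition goodw :: "'a \<Rightarrow> 'a list \<Rightarrow> nat" where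
  "goodw f us = (\<Sum>u\<leftarrow>us. if E u f \<and> \<not> bad f us u then w u else 0)"

text \<open>The half of the feedback property of median orders that the argument uses.\<close>

definition feedback :: "'a list \<Rightarrow> bool" where
  "feedback xs \<longleftrightarrow> (\<forall>ps us v ss. xs = ps @ us @ v # ss \<longrightarrow> outw v us \<le> inw v us)"

lemma outw_append [simp]: "outw v (us @ vs) = outw v us + outw v vs"
  by (simp add: outw_def)

lemma outw_simps [simp]: "outw v [] = 0" "outw v (u # us) = (if E v u then w u else 0) + outw v us"
  by (simp_all add: outw_def)

lemma inw_append [simp]: "inw v (us @ vs) = inw v us + inw v vs"
  by (simp add: inw_def)

lemma cross_append1 [simp]: "cross (us @ vs) xs = cross us xs + cross vs xs"
  by (simp add: cross_def)

lemma cross_append2 [simp]: "cross xs (us @ vs) = cross xs us + cross xs vs"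
  by (simp add: cross_def sum_list_addf algebra_simps)

lemma score_append: "score (us @ vs) = score us + score vs + cross us vs"
  by (induction us) (auto simp: cross_def algebra_simps)

lemma cross_single1: "cross [v] us = w v * outw v us"
  by (simp add: cross_def)

lemma cross_single2: "cross us [v] = w v * inw v us"
  by (induction us) (auto simp: cross_def inw_def algebra_simps)

lemma median_orderD: "median_order V xs \<Longrightarrow> distinct ys \<Longrightarrow> set ys = V \<Longrightarrow> score ys \<le> score xs"
  by (auto simp: median_order_def orders_def)

section \<open>Existence and feedback property of median orders\<close>

lemma finite_orders: "finite V \<Longrightarrow> finite (orders V)"
  unfolding orders_def by (rule finite_subset[OF _ finite_subset_distinct[of V]]) auto

lemma median_order_exists:
  assumes "finite V"
  obtains xs where "median_order V xs"
proof -
  obtain xs0 where "xs0 \<in> orders V"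
    using finite_distinct_list[OF assms] by (auto simp: orders_def)
  then have "\<exists>xs. xs \<in> orders V \<and> (\<forall>ys. ys \<in> orders V \<longrightarrow> score ys \<le> score xs)"
    by (intro ex_has_greatest_nat[where b = "Suc (Max (score ` orders V))"])
       (auto simp: less_Suc_eq_le assms finite_orders)
  then show ?thesis
    using that by (auto simp: median_order_def)
qed

lemma median_order_feedback:
  assumes med: "median_order V xs" and pos: "\<And>v. v \<in> V \<Longrightarrow> 0 < w v"
  shows "feedback xs"
  unfolding feedback_def
proof (intro allI impI)
  fix ps us v ss
  assume xs: "xs = ps @ us @ v # ss"
  have V: "distinct xs" "set xs = V"
    using med by (auto simp: median_order_def orders_def)
  \<comment> \<open>Moving \<open>v\<close> in front of \<open>us\<close> cannot raise the score.
    The change is \<open>w v\<close> times the difference of \<open>outw v us\<close> and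
    \<open>inw v us\<close>, and the positive factor cancels.\<close>
  have "score (ps @ v # us @ ss) \<le> score xs"
    by (rule median_orderD[OF med]) (use V xs in auto)
  then have "score (ps @ [v] @ us @ ss) \<le> score (ps @ us @ [v] @ ss)"
    by (simp add: xs)
  then have "w v * outw v us \<le> w v * inw v us"
    by (simp add: score_append cross_single1[symmetric] cross_single2[symmetric] del: append_Cons)
  then show "outw v us \<le> inw v us"
    using pos[of v] V xs by auto
qed

lemma feedback_suffix: "feedback (ps @ xs) \<Longrightarrow> feedback xs"
  unfolding feedback_def by (metis append.assoc)

section \<open>Good and bad in-neighbours of the feed vertex\<close>

lemma bad_suffix:
  assumes "u \<notin> set ps" "bad f (ps @ ss) u"
  shows "bad f ss u"
proof -
  have "takeWhile (\<lambda>v. v \<noteq> u) (ps @ ss) = ps @ takeWhile (\<lambda>v. v \<noteq> u) ss"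
    by (rule takeWhile_append2) (use assms in auto)
  then show ?thesis
    using assms by (auto simp: bad_def)
qed

lemma bad_pred:
  assumes "bad f (ps @ b # ss) b" "b \<notin> set ps" "u \<in> set ps" "E f u"
  shows "E b u"
proof -
  have "takeWhile (\<lambda>v. v \<noteq> b) (ps @ b # ss) = ps"
    using assms(2) by (subst takeWhile_append2) auto
  then show ?thesis
    using assms by (auto simp: bad_def)
qed

text \<open>Cutting off a prefix leaves fewer vertices that \<open>u\<close> must dominate, so bad
  vertices stay bad and good weight is never gained.\<close>

lemma goodw_suffix:
  assumes "distinct (ps @ ss)"
  shows "goodw f ss \<le> (\<Sum>u\<leftarrow>ss. if E u f \<and> \<not> bad f (ps @ ss) u then w u else 0)"
  unfolding goodw_def
  by (rule sum_list_mono) (use assms bad_suffix[of _ ps f ss] in auto)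

text \<open>Split at the first bad vertex \<open>b\<close>. Before \<open>b\<close>, out-neighbours
  of \<open>f\<close> are out-neighbours of \<open>b\<close>; feedback at \<open>b\<close> bounds
  their weight by that of the in-neighbours of \<open>b\<close>, which are good in-neighbours of
  \<open>f\<close>. After \<open>b\<close>, use induction, as feedback passes to suffixes.\<close>

lemma outw_le_goodw:
  assumes "tournament_on (set (us @ [f])) E" "distinct (us @ [f])" "feedback (us @ [f])"
  shows "outw f us \<le> goodw f us"
  using assms
proof (induction us rule: length_induct)
  case (1 us)
  have asym: "\<And>u v. E u v \<Longrightarrow> \<not> E v u"
    and tot: "\<And>u v. u \<in> set us \<union> {f} \<Longrightarrow> v \<in> set us \<union> {f} \<Longrightarrow> u \<noteq> v \<Longrightarrow> E u v \<or> E v u"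
    using "1.prems"(1) by (auto simp: tournament_on_def)
  show ?case
  proof (cases "\<exists>b \<in> set us. bad f us b")
    case False
    have "outw f us \<le> inw f us"
      using "1.prems"(3) unfolding feedback_def by (metis append_Nil)
    also have "\<dots> = goodw f us"
      unfolding goodw_def inw_def using False by (intro arg_cong[of _ _ sum_list] map_cong) auto
    finally show ?thesis .
  next
    case True
    then obtain ps b ss where us: "us = ps @ b # ss" and b: "bad f us b"
      and ps: "\<forall>u \<in> set ps. \<not> bad f us u"
      using split_list_first_prop[OF True] by blast
    have Ebf: "E b f"
      using b by (simp add: bad_def)
    have bps: "b \<notin> set ps"
      using us "1.prems"(2) by auto
    have "outw f ps \<le> outw b ps"
      unfolding outw_def
      by (rule sum_list_mono) (use bad_pred[of f ps b ss] b us bps in auto)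
    also have "\<dots> \<le> inw b ps"
      using "1.prems"(3) us unfolding feedback_def by (metis append_Nil append.assoc append_Cons)
    also have "\<dots> \<le> (\<Sum>u\<leftarrow>ps. if E u f \<and> \<not> bad f us u then w u else 0)"
      unfolding inw_def
    proof (rule sum_list_mono)
      fix u assume u: "u \<in> set ps"
      \<comment> \<open>If \<open>f\<close> dominated \<open>u\<close>, badness of \<open>b\<close>
        would give \<open>E b u\<close>, against \<open>E u b\<close>.\<close>
      have "E u f" if "E u b"
      proof -
        have "\<not> E f u"
          using bad_pred[of f ps b ss u] b us bps u that asym by auto
        moreover have "u \<noteq> f"
          using u us "1.prems"(2) by auto
        ultimately show ?thesis
          using tot[of u f] u us by auto
      qed
      then show "(if E u b then w u else 0) \<le> (if E u f \<and> \<not> bad f us u then w u else 0)"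
        using ps u by auto
    qed
    finally have *: "outw f ps \<le> (\<Sum>u\<leftarrow>ps. if E u f \<and> \<not> bad f us u then w u else 0)" .
    have "outw f ss \<le> goodw f ss"
    proof (rule "1.IH"[rule_format])
      show "length ss < length us" by (simp add: us)
      show "tournament_on (set (ss @ [f])) E"
        using "1.prems"(1) us by (auto simp: tournament_on_def)
      show "distinct (ss @ [f])"
        using "1.prems"(2) us by auto
      show "feedback (ss @ [f])"
        using "1.prems"(3) us feedback_suffix[of "ps @ [b]" "ss @ [f]"] by simp
    qed
    also have "\<dots> \<le> (\<Sum>u\<leftarrow>ss. if E u f \<and> \<not> bad f us u then w u else 0)"
      using goodw_suffix[of "ps @ [b]" ss f] us "1.prems"(2) by simp
    finally have "outw f ss \<le> (\<Sum>u\<leftarrow>ss. if E u f \<and> \<not> bad f us u then w u else 0)" .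
    with * show ?thesis
      using b Ebf asym us by (simp add: goodw_def)
  qed
qed

section \<open>Sedimentation of median orders\<close>

text \<open>Pulling a \<open>P\<close>-vertex forward past the earlier non-\<open>P\<close> vertices
  reverses its position relative to those only, and the hypothesis says that this loses
  nothing.\<close>

lemma score_partition:
  assumes "\<And>ps b ss. us = ps @ b # ss \<Longrightarrow> P b \<Longrightarrow>
    inw b (filter (\<lambda>u. \<not> P u) ps) \<le> outw b (filter (\<lambda>u. \<not> P u) ps)"
  shows "score us \<le> score (filter P us @ filter (\<lambda>u. \<not> P u) us)"
  using assms
proof (induction us rule: rev_induct)
  case (snoc u us)
  have IH: "score us \<le> score (filter P us @ filter (\<lambda>u. \<not> P u) us)"
    using snoc by simp
  have cr: "cross us [u] = cross (filter P us) [u] + cross (filter (\<lambda>u. \<not> P u) us) [u]"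
    unfolding cross_def by (induction us) auto
  show ?case
  proof (cases "P u")
    case False
    then show ?thesis
      using IH cr by (simp add: score_append)
  next
    case True
    have "cross (filter (\<lambda>u. \<not> P u) us) [u] \<le> cross [u] (filter (\<lambda>u. \<not> P u) us)"
      using snoc.prems[of us u "[]"] True by (simp add: cross_single1 cross_single2)
    then show ?thesis
      using True IH cr by (simp add: score_append del: append_Cons)
  qed
qed simp

text \<open>Sedimentation: when the feed vertex satisfies its inequality with equality, moving the bad
  vertices and then the feed vertex to the front gives another median order.\<close>

lemma median_order_sediment:
  fixes us :: "'a list" and f :: 'a
  defines "P \<equiv> \<lambda>u. bad f us u \<or> u = f"
  assumes tour: "tournament_on V E" and med: "median_order V (us @ [f])"
    and fb: "feedback (us @ [f])" and eq: "goodw f us \<le> outw f us"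
  shows "median_order V (filter P (us @ [f]) @ filter (\<lambda>u. \<not> P u) (us @ [f]))"
proof -
  let ?S = "filter P (us @ [f]) @ filter (\<lambda>u. \<not> P u) (us @ [f])"
  have V: "distinct (us @ [f])" "set (us @ [f]) = V"
    using med by (auto simp: median_order_def orders_def)
  have asym: "\<And>u v. E u v \<Longrightarrow> \<not> E v u"
    and tot: "\<And>u v. u \<in> V \<Longrightarrow> v \<in> V \<Longrightarrow> u \<noteq> v \<Longrightarrow> E u v \<or> E v u"
    using tour by (auto simp: tournament_on_def)
  \<comment> \<open>Among the unmoved vertices of \<open>ps\<close>, in-neighbours of
    \<open>b\<close> are good in-neighbours of \<open>f\<close>; out-neighbours of \<open>f\<close>
    are never moved and are dominated by \<open>b\<close>. So \<open>pref\<close> carries over from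
    \<open>f\<close> to \<open>b\<close>.\<close>
  have key: "inw b (filter (\<lambda>u. \<not> P u) ps) \<le> outw b (filter (\<lambda>u. \<not> P u) ps)"
    if sub: "set ps \<subseteq> set us" and fps: "f \<notin> set ps"
      and pref: "(\<Sum>u\<leftarrow>ps. if E u f \<and> \<not> bad f us u then w u else 0) \<le> outw f ps"
      and dom: "\<And>u. u \<in> set ps \<Longrightarrow> E f u \<Longrightarrow> E b u" for ps b
  proof -
    have "inw b (filter (\<lambda>u. \<not> P u) ps) \<le> inw f (filter (\<lambda>u. \<not> P u) ps)"
      unfolding inw_def
    proof (rule sum_list_mono)
      fix u assume u: "u \<in> set (filter (\<lambda>u. \<not> P u) ps)"
      have "E u f" if "E u b"
        using tot[of u f] dom[of u] that asym u fps sub V by auto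
      then show "(if E u b then w u else 0) \<le> (if E u f then w u else 0)" by auto
    qed
    also have "\<dots> = (\<Sum>u\<leftarrow>ps. if E u f \<and> \<not> bad f us u then w u else 0)"
      using fps unfolding inw_def P_def by (induction ps) auto
    also have "\<dots> \<le> outw f ps" by (rule pref)
    also have "\<dots> = outw f (filter (\<lambda>u. \<not> P u) ps)"
      using fps asym unfolding outw_def P_def by (induction ps) (auto simp: bad_def)
    also have "\<dots> \<le> outw b (filter (\<lambda>u. \<not> P u) ps)"
      unfolding outw_def by (rule sum_list_mono) (use dom in auto)
    finally show ?thesis .
  qed
  have "score (us @ [f]) \<le> score ?S"
  proof (rule score_partition)
    fix ps b ss
    assume dec: "us @ [f] = ps @ b # ss" and "P b"
    show "inw b (filter (\<lambda>u. \<not> P u) ps) \<le> outw b (filter (\<lambda>u. \<not> P u) ps)"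
    proof (cases "b = f")
      case True
      \<comment> \<open>For \<open>b = f\<close> the prefix is all of \<open>us\<close>, and the
        bound \<open>pref\<close> is \<open>eq\<close> itself.\<close>
      then have "ps = us"
        using dec V(1) by (cases ss rule: rev_cases) auto
      then show ?thesis
        using key[of us b] V(1) eq True by (auto simp: goodw_def)
    next
      case False
      then obtain ss' where us: "us = ps @ b # ss'" and ss: "ss = ss' @ [f]"
        using dec by (cases ss rule: rev_cases) auto
      have b: "bad f us b" and Ebf: "E b f"
        using \<open>P b\<close> False by (auto simp: P_def bad_def)
      have "outw f ss' \<le> goodw f ss'"
      proof (rule outw_le_goodw)
        show "tournament_on (set (ss' @ [f])) E"
          using tour us V by (auto simp: tournament_on_def)
        show "distinct (ss' @ [f])"
          using V us by auto
        show "feedback (ss' @ [f])"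
          using fb us feedback_suffix[of "ps @ [b]" "ss' @ [f]"] by simp
      qed
      also have "\<dots> \<le> (\<Sum>u\<leftarrow>ss'. if E u f \<and> \<not> bad f us u then w u else 0)"
        using goodw_suffix[of "ps @ [b]" ss' f] us V by simp
      finally have "outw f ss' \<le> (\<Sum>u\<leftarrow>ss'. if E u f \<and> \<not> bad f us u then w u else 0)" .
      \<comment> \<open>By \<open>eq\<close> the good weight of \<open>us\<close> is at most the
        out-weight. On the suffix the inequality goes the other way and \<open>b\<close> counts on
        neither side, so the prefix inherits the bound.\<close>
      then have pref: "(\<Sum>u\<leftarrow>ps. if E u f \<and> \<not> bad f us u then w u else 0) \<le> outw f ps"
        using eq b Ebf asym us by (simp add: goodw_def)
      show ?thesis
      proof (rule key[OF _ _ pref])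
        show "E b u" if "u \<in> set ps" "E f u" for u
          using bad_pred[of f ps b ss' u] b us that V by auto
      qed (use us V in auto)
    qed
  qed
  moreover have "?S \<in> orders V"
    using V by (auto simp: orders_def)
  ultimately show ?thesis
    using med unfolding median_order_def by (meson order_trans)
qed

section \<open>Second neighbourhoods in weighted tournaments\<close>

lemma outw_eq_sum: "distinct us \<Longrightarrow> outw f us = sum w {u \<in> set us. E f u}"
  by (simp add: outw_def sum_list_distinct_conv_sum_set sum.inter_filter)

lemma goodw_eq_sum: "distinct us \<Longrightarrow> goodw f us = sum w {u \<in> set us. E u f \<and> \<not> bad f us u}"
  by (simp add: goodw_def sum_list_distinct_conv_sum_set sum.inter_filter)

text \<open>A vertex \<open>v\<close> witnessing that \<open>u\<close> is not bad is the middle of a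
  path from \<open>f\<close> to \<open>u\<close>.\<close>

lemma good_in_nbrs2:
  assumes "tournament_on V E" "distinct (us @ [f])" "set (us @ [f]) = V"
    and "u \<in> set us" "E u f" "\<not> bad f us u"
  shows "u \<in> nbrs2 V E f"
proof -
  obtain v where v: "v \<in> set (takeWhile (\<lambda>v. v \<noteq> u) us)" "E f v" "\<not> E u v"
    using assms by (auto simp: bad_def)
  then have "v \<in> set us" "v \<noteq> u"
    by (auto dest: set_takeWhileD)
  then have "E v u"
    using v assms unfolding tournament_on_def by auto
  with v \<open>v \<in> set us\<close> assms show ?thesis
    unfolding nbrs2_def tournament_on_def by auto
qed

text \<open>The last vertex of any median order works: its out-weight is at most its good weight,
  and good vertices are second out-neighbours.\<close>

lemma exists_seymour_vertex:
  assumes "tournament_on V E" "V \<noteq> {}" "\<And>v. v \<in> V \<Longrightarrow> 0 < w v"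
  shows "\<exists>v \<in> V. seymour V E w v"
proof -
  have fin: "finite V"
    using assms by (simp add: tournament_on_def)
  obtain xs where med: "median_order V xs"
    using median_order_exists fin by blast
  with assms(2) obtain us f where xs: "xs = us @ [f]"
    by (cases xs rule: rev_cases) (auto simp: median_order_def orders_def)
  have V: "distinct (us @ [f])" "set (us @ [f]) = V"
    using med xs by (auto simp: median_order_def orders_def)
  have "feedback (us @ [f])"
    using median_order_feedback[OF med assms(3)] xs by simp
  then have "outw f us \<le> goodw f us"
    using V assms(1) by (intro outw_le_goodw) auto
  moreover have "nbrs V E f = {u \<in> set us. E f u}"
    using V assms(1) by (auto simp: nbrs_def tournament_on_def)
  moreover have "goodw f us \<le> sum w (nbrs2 V E f)"
    unfolding goodw_eq_sum[OF distinct_append[THEN iffD1, OF V(1), THEN conjunct1]]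
    by (rule sum_mono2) (use fin good_in_nbrs2[OF assms(1) V] in \<open>auto simp: nbrs2_def\<close>)
  ultimately show ?thesis
    using V by (auto simp: seymour_def outw_eq_sum)
qed

text \<open>Take a median order of \<open>V - {f}\<close> that places a fixed out-neighbour \<open>x\<close> of \<open>f\<close> as late as
  possible. If its feed vertex failed, sedimentation would move \<open>x\<close> further back.\<close>

lemma exists_other_seymour_vertex:
  assumes tour: "tournament_on V E" and pos: "\<And>v. v \<in> V \<Longrightarrow> 0 < w v"
    and f: "f \<in> V" "w f = 1" and x: "x \<in> V" "E f x"
  shows "\<exists>v \<in> V. v \<noteq> f \<and> seymour V E w v"
proof -
  let ?V = "V - {f}"
  let ?pos = "\<lambda>xs. length (takeWhile (\<lambda>v. v \<noteq> x) xs)"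
  have fin: "finite V" and asym: "\<And>u v. E u v \<Longrightarrow> \<not> E v u"
    using tour by (auto simp: tournament_on_def)
  have tour': "tournament_on ?V E"
    using tour by (auto simp: tournament_on_def)
  obtain xs0 where "median_order ?V xs0"
    using median_order_exists[of ?V] fin by auto
  moreover have "?pos ys < Suc (card ?V)" if "median_order ?V ys" for ys
    using that distinct_card[of ys] length_takeWhile_le[of _ ys]
    by (auto simp: median_order_def orders_def less_Suc_eq_le)
  ultimately have "\<exists>xs. median_order ?V xs \<and> (\<forall>ys. median_order ?V ys \<longrightarrow> ?pos ys \<le> ?pos xs)"
    by (intro ex_has_greatest_nat) auto
  then obtain xs where med: "median_order ?V xs"
    and latest: "\<And>ys. median_order ?V ys \<Longrightarrow> ?pos ys \<le> ?pos xs" by blast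
  have "x \<in> set xs"
    using med x asym by (auto simp: median_order_def orders_def)
  then obtain us y where xs: "xs = us @ [y]"
    by (cases xs rule: rev_cases) auto
  have V: "distinct (us @ [y])" "set (us @ [y]) = ?V"
    using med xs by (auto simp: median_order_def orders_def)
  have y: "y \<in> V" "y \<noteq> f" and f_us: "f \<notin> set us" and dist: "distinct us"
    using V by auto
  have fb: "feedback (us @ [y])"
    using median_order_feedback[OF med pos] xs by simp
  have le: "outw y us \<le> goodw y us"
    by (rule outw_le_goodw) (use V tour' fb in auto)
  let ?G = "{u \<in> set us. E u y \<and> \<not> bad y us u}"
  have good: "?G \<subseteq> nbrs2 V E y"
    using good_in_nbrs2[OF tour' V] by (auto simp: nbrs2_def)
  have fin2: "finite (nbrs2 V E y)"
    using fin by (simp add: nbrs2_def)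
  have good_le: "goodw y us \<le> sum w (nbrs2 V E y)"
    unfolding goodw_eq_sum[OF dist] by (rule sum_mono2[OF fin2 good]) simp
  \<comment> \<open>Putting \<open>f\<close> back adds at most \<open>f\<close>, of weight 1, to the
    out-neighbours of \<open>y\<close>. The cases below recover this unit.\<close>
  have out: "nbrs V E y = {u \<in> set us. E y u} \<union> (if E y f then {f} else {})"
  proof -
    have "V = insert f (insert y (set us))" "\<not> E y y"
      using V f asym by auto
    then show ?thesis
      by (auto simp: nbrs_def)
  qed
  have "seymour V E w y"
  proof (cases "E y f")
    case False
    then show ?thesis
      using le good_le out dist by (simp add: seymour_def outw_eq_sum)
  next
    case True
    have sum_out: "sum w (nbrs V E y) = outw y us + 1"
      using True out dist f f_us by (simp add: outw_eq_sum)
    show ?thesis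
    proof (cases "outw y us < goodw y us")
      case True
      then show ?thesis
        using sum_out good_le by (simp add: seymour_def)
    next
      case False
      then have eq: "goodw y us = outw y us"
        using le by simp
      have x_us: "x \<in> set us" and xy: "x \<noteq> y"
        using \<open>x \<in> set xs\<close> xs True asym x by auto
      show ?thesis
      proof (cases "bad y us x")
        case True
        \<comment> \<open>The path is \<open>y\<close>, \<open>f\<close>, \<open>x\<close>; being
          bad, \<open>x\<close> is not yet counted in \<open>?G\<close>.\<close>
        have "x \<in> nbrs2 V E y"
          using True \<open>E y f\<close> x f xy asym by (auto simp: nbrs2_def bad_def)
        then have "sum w (insert x ?G) \<le> sum w (nbrs2 V E y)"
          using good by (intro sum_mono2[OF fin2]) auto
        moreover have "sum w (insert x ?G) = w x + goodw y us"
          using True by (simp add: goodw_eq_sum[OF dist])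
        ultimately show ?thesis
          using sum_out eq pos[OF x(1)] by (simp add: seymour_def)
      next
        case False
        \<comment> \<open>Sedimentation contradicts the choice of \<open>xs\<close>: all vertices
          before \<open>x\<close> stay before it, and \<open>y\<close>, formerly last, joins
          them.\<close>
        define P where "P = (\<lambda>u. bad y us u \<or> u = y)"
        let ?S = "filter P (us @ [y]) @ filter (\<lambda>u. \<not> P u) (us @ [y])"
        have "median_order ?V ?S"
          using median_order_sediment[OF tour' med[unfolded xs] fb] eq by (simp add: P_def)
        then have "?pos ?S \<le> ?pos (us @ [y])"
          using latest xs by blast
        moreover obtain ps ss where ps: "us = ps @ x # ss" "x \<notin> set ps"
          using split_list_first[OF x_us] by blast
        have "\<not> P x" using False xy by (simp add: P_def)
        have "?pos (us @ [y]) = length ps"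
        proof -
          have "takeWhile (\<lambda>v. v \<noteq> x) (ps @ x # ss @ [y]) = ps"
            using ps by (subst takeWhile_append2) auto
          then show ?thesis by (simp add: ps)
        qed
        moreover have "takeWhile (\<lambda>v. v \<noteq> x) ?S =
            filter P (us @ [y]) @ takeWhile (\<lambda>v. v \<noteq> x) (filter (\<lambda>u. \<not> P u) (us @ [y]))"
          using \<open>\<not> P x\<close> by (intro takeWhile_append2) (auto split: if_splits)
        moreover have "takeWhile (\<lambda>v. v \<noteq> x) (filter (\<lambda>u. \<not> P u) (us @ [y])) = filter (\<lambda>u. \<not> P u) ps"
        proof -
          have "filter (\<lambda>u. \<not> P u) (us @ [y]) =
              filter (\<lambda>u. \<not> P u) ps @ x # filter (\<lambda>u. \<not> P u) ss"
            using ps \<open>\<not> P x\<close> by (simp add: P_def)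
          moreover have "takeWhile (\<lambda>v. v \<noteq> x) (filter (\<lambda>u. \<not> P u) ps @ x # filter (\<lambda>u. \<not> P u) ss) =
              filter (\<lambda>u. \<not> P u) ps"
            using ps by (subst takeWhile_append2) auto
          ultimately show ?thesis by simp
        qed
        moreover have "length (filter P (us @ [y])) \<ge> length (filter P ps) + 1"
          using ps by (simp add: P_def)
        moreover have "length (filter P ps) + length (filter (\<lambda>u. \<not> P u) ps) = length ps"
          by (rule sum_length_filter_compl)
        ultimately show ?thesis by simp
      qed
    qed
  qed
  with y show ?thesis by blast
qed

end

section \<open>Contracting a module\<close>

text \<open>\<open>T\<close> keeps \<open>a\<close> as representative of \<open>K\<close>, with
  weight \<open>card K\<close>. A vertex outside \<open>K\<close> has all or none of
  \<open>K\<close> in each neighbourhood, so weights on \<open>T\<close> count vertices of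
  \<open>V\<close>. For a vertex of \<open>K\<close>, its neighbourhoods inside \<open>K\<close> are
  combined with those of \<open>a\<close> in \<open>T\<close>.\<close>

lemma two_seymour_vertices_if_module:
  fixes E :: "'a \<Rightarrow> 'a \<Rightarrow> bool"
  assumes fin: "finite V" and KV: "K \<subseteq> V" and asym: "\<And>u v. E u v \<Longrightarrow> \<not> E v u"
    and tot: "\<And>u v. u \<in> V \<Longrightarrow> v \<in> V - K \<Longrightarrow> u \<noteq> v \<Longrightarrow> E u v \<or> E v u"
    and module: "\<And>u v t. u \<in> K \<Longrightarrow> v \<in> K \<Longrightarrow> t \<in> V - K \<Longrightarrow> E u t \<Longrightarrow> E v t"
    and no_sink: "\<And>u. u \<in> V \<Longrightarrow> \<exists>v \<in> V. E u v"
    and ab: "a \<in> K" "b \<in> K" "a \<noteq> b" "seymour K E (\<lambda>_. 1) a" "seymour K E (\<lambda>_. 1) b"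
  shows "\<exists>u \<in> V. \<exists>v \<in> V. u \<noteq> v \<and> seymour V E (\<lambda>_. 1) u \<and> seymour V E (\<lambda>_. 1) v"
proof -
  define T where "T = insert a (V - K)"
  define w where "w = (\<lambda>v. if v = a then card K else 1)"
  have finK: "finite K"
    using fin KV finite_subset by blast
  have K_pos: "0 < card K"
    using finK ab by (auto simp: card_gt_0_iff)
  have a: "a \<in> V" "a \<in> T"
    using KV ab by (auto simp: T_def)
  \<comment> \<open>\<open>module\<close> concerns arcs leaving \<open>K\<close>; totality and
    antisymmetry turn it into a statement on arcs entering \<open>K\<close>.\<close>
  have module': "E t v" if "u \<in> K" "v \<in> K" "t \<in> V - K" "E t u" for u v t
    using that module[of v u t] tot[of v t] asym[of t u] KV by auto
  have tour: "tournament_on T E"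
    unfolding tournament_on_def T_def using fin asym tot a by (auto 4 3)
  have w_pos: "0 < w v" for v
    using K_pos by (simp add: w_def)
  have sum_w: "sum w S = card S" if "a \<notin> S" for S
  proof -
    have "sum w S = (\<Sum>v\<in>S. 1)"
      by (rule sum.cong) (use that in \<open>auto simp: w_def\<close>)
    then show ?thesis by simp
  qed
  have card_eq: "card S = sum w (S \<inter> T)" if S: "S \<subseteq> V" "K \<subseteq> S \<or> K \<inter> S = {}" for S
  proof (cases "K \<subseteq> S")
    case True
    have "S \<inter> T = insert a (S - K)"
      using True S ab by (auto simp: T_def)
    moreover have "card S = card K + card (S - K)"
      using True finK S fin by (metis card_Diff_subset card_mono finite_subset le_add_diff_inverse)
    ultimately show ?thesis
      using S fin ab sum_w[of "S - K"] by (simp add: finite_subset w_def)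
  next
    case False
    then have "S \<inter> T = S" "a \<notin> S"
      using S ab by (auto simp: T_def)
    then show ?thesis by (simp add: sum_w)
  qed
  have outer: "seymour V E (\<lambda>_. 1) u" if u: "u \<in> V - K" and su: "seymour T E w u" for u
  proof -
    have "card (nbrs V E u) = sum w (nbrs V E u \<inter> T)"
      by (rule card_eq) (use module' u KV in \<open>auto simp: nbrs_def\<close>)
    also have "nbrs V E u \<inter> T = nbrs T E u"
      using a by (auto simp: nbrs_def T_def)
    also have "sum w (nbrs T E u) \<le> sum w (nbrs2 T E u)"
      using su by (simp add: seymour_def)
    also have "\<dots> \<le> sum w (nbrs2 V E u \<inter> T)"
      by (rule sum_mono2) (use fin a in \<open>auto simp: nbrs2_def T_def\<close>)
    also have "\<dots> = card (nbrs2 V E u)"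
    proof (rule card_eq[symmetric])
      \<comment> \<open>The middle vertex of a path from \<open>u\<close> to \<open>p\<close> lies
        outside \<open>K\<close>, as otherwise \<open>u\<close> would dominate \<open>p\<close>
        directly. Hence it dominates \<open>q\<close> too.\<close>
      have "q \<in> nbrs2 V E u" if pq: "p \<in> K" "p \<in> nbrs2 V E u" "q \<in> K" for p q
      proof -
        obtain t where t: "t \<in> V" "E u t" "E t p" and nup: "\<not> E u p"
          using pq by (auto simp: nbrs2_def)
        have "t \<in> V - K"
          using module'[of t p u] u pq t nup by auto
        then show ?thesis
          using module'[of p q t] module'[of q p u] pq t nup u KV by (auto simp: nbrs2_def)
      qed
      then show "K \<subseteq> nbrs2 V E u \<or> K \<inter> nbrs2 V E u = {}" by blast
    qed (auto simp: nbrs2_def)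
    finally show ?thesis by (simp add: seymour_def)
  qed
  have inner: "seymour V E (\<lambda>_. 1) u"
    if u: "u \<in> K" "seymour K E (\<lambda>_. 1) u" and sa: "seymour T E w a" for u
  proof -
    have same: "E u t \<longleftrightarrow> E a t" if "t \<in> V - K" for t
      using module[of u a t] module[of a u t] that u ab by auto
    have "nbrs V E u = nbrs K E u \<union> nbrs T E a"
      using same KV asym u by (auto simp: nbrs_def T_def)
    moreover have "nbrs T E a \<subseteq> V - K"
      using asym by (auto simp: nbrs_def T_def)
    ultimately have 1: "card (nbrs V E u) \<le> card (nbrs K E u) + card (nbrs T E a)"
      by (simp add: card_Un_le)
    have "nbrs2 K E u \<union> nbrs2 T E a \<subseteq> nbrs2 V E u"
    proof
      fix v assume "v \<in> nbrs2 K E u \<union> nbrs2 T E a"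
      then show "v \<in> nbrs2 V E u"
      proof
        assume v: "v \<in> nbrs2 T E a"
        then obtain t where "t \<in> V - K" "E a t" "E t v"
          using asym by (auto simp: nbrs2_def T_def)
        then show ?thesis
          using v same u KV by (auto simp: nbrs2_def T_def)
      qed (use KV in \<open>auto simp: nbrs2_def\<close>)
    qed
    moreover have "nbrs2 K E u \<inter> nbrs2 T E a = {}" "finite (nbrs2 K E u)" "finite (nbrs2 T E a)"
      "finite (nbrs2 V E u)"
      using fin finK by (auto simp: nbrs2_def T_def)
    ultimately have 2: "card (nbrs2 K E u) + card (nbrs2 T E a) \<le> card (nbrs2 V E u)"
      by (metis card_Un_disjoint card_mono)
    have "a \<notin> nbrs T E a" "a \<notin> nbrs2 T E a"
      using asym by (auto simp: nbrs_def nbrs2_def)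
    then have "card (nbrs T E a) \<le> card (nbrs2 T E a)"
      using sa by (simp add: seymour_def sum_w)
    with 1 2 u(2) show ?thesis
      by (simp add: seymour_def)
  qed
  show ?thesis
  proof (cases "seymour T E w a")
    case True
    then show ?thesis
      using inner ab KV by blast
  next
    case False
    \<comment> \<open>As \<open>a\<close> fails, every vertex found in \<open>T\<close> lies outside
      \<open>K\<close> and has weight 1.\<close>
    obtain f where f: "f \<in> T" "seymour T E w f"
      using exists_seymour_vertex[OF tour, of w] w_pos a by blast
    have fa: "f \<noteq> a" "f \<in> V - K"
      using f False by (auto simp: T_def)
    obtain t where t: "t \<in> V" "E f t"
      using no_sink fa by blast
    \<comment> \<open>If \<open>t\<close> lies in \<open>K\<close>, then \<open>f\<close> dominates
      \<open>a\<close>, so an out-neighbour survives the contraction.\<close>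
    have "\<exists>t' \<in> T. E f t'"
      using t module'[of t a f] ab fa by (cases "t \<in> K") (auto simp: T_def)
    then obtain g where "g \<in> T" "g \<noteq> f" "seymour T E w g"
      using exists_other_seymour_vertex[OF tour, of w f] w_pos f fa by (auto simp: w_def)
    moreover from this have "g \<in> V - K"
      using False by (auto simp: T_def)
    ultimately show ?thesis
      using outer f fa by blast
  qed
qed

section \<open>The dependency digraph\<close>

text \<open>Membership of \<open>v\<close> in the union of N+(u) and N++(u).\<close>

definition reach2 :: "('a \<Rightarrow> 'a \<Rightarrow> bool) \<Rightarrow> 'a \<Rightarrow> 'a \<Rightarrow> bool" where
  "reach2 E u v \<longleftrightarrow> E u v \<or> (v \<noteq> u \<and> (\<exists>t. E u t \<and> E t v))"

definition loses :: "('a \<Rightarrow> 'a \<Rightarrow> bool) \<Rightarrow> 'a set \<Rightarrow> 'a set \<Rightarrow> bool" where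
  "loses E e e' \<longleftrightarrow> (\<exists>x1 y1 x2 y2. e = {x1, y1} \<and> e' = {x2, y2} \<and>
     E x1 x2 \<and> \<not> reach2 E x1 y2 \<and> E y1 y2 \<and> \<not> reach2 E y1 x2)"

definition spokes :: "'a \<Rightarrow> 'a set \<Rightarrow> 'a set set" where
  "spokes x A = {{a, x} | a. a \<in> A}"

lemma loses_doubleton:
  "loses E {p, q} {r, s} \<longleftrightarrow>
     (E p r \<and> \<not> reach2 E p s \<and> E q s \<and> \<not> reach2 E q r) \<or>
     (E p s \<and> \<not> reach2 E p r \<and> E q r \<and> \<not> reach2 E q s)"
  unfolding loses_def doubleton_eq_iff by blast

text \<open>The centres are listed in the order of the triangle, with leaf sets \<open>A\<close>,
  \<open>B\<close>, \<open>C\<close>; \<open>succ\<close> and \<open>pred\<close> express that the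
  dependency digraph has no sink and no source.\<close>

locale missing_stars =
  fixes V :: "'a set" and E :: "'a \<Rightarrow> 'a \<Rightarrow> bool" and x y z :: 'a and A B C :: "'a set"
  assumes fin: "finite V"
    and in_V: "E u v \<Longrightarrow> u \<in> V \<and> v \<in> V"
    and asym: "E u v \<Longrightarrow> \<not> E v u"
    and nonempty: "A \<noteq> {}" "B \<noteq> {}" "C \<noteq> {}"
    and sub: "insert x A \<subseteq> V" "insert y B \<subseteq> V" "insert z C \<subseteq> V"
    and centre: "x \<notin> A" "y \<notin> B" "z \<notin> C"
    and disj: "insert x A \<inter> insert y B = {}" "insert y B \<inter> insert z C = {}"
      "insert z C \<inter> insert x A = {}"
    and missing: "u \<in> V \<Longrightarrow> v \<in> V \<Longrightarrow> u \<noteq> v \<Longrightarrow>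
      \<not> E u v \<and> \<not> E v u \<longleftrightarrow> {u, v} \<in> spokes x A \<union> spokes y B \<union> spokes z C"
    and triangle: "E x y" "E y z" "E z x"
    and succ: "e \<in> spokes x A \<union> spokes y B \<union> spokes z C \<Longrightarrow>
      \<exists>e' \<in> spokes x A \<union> spokes y B \<union> spokes z C. loses E e e'"
    and pred: "e \<in> spokes x A \<union> spokes y B \<union> spokes z C \<Longrightarrow>
      \<exists>e' \<in> spokes x A \<union> spokes y B \<union> spokes z C. loses E e' e"
begin

definition K where "K = insert x A \<union> insert y B \<union> insert z C"

text \<open>Cyclic symmetry: what is proved for the stars of \<open>x\<close> and \<open>y\<close>
  becomes available for the other two consecutive pairs.\<close>

lemma rotate: "missing_stars V E y z x B C A"
proof -
  have "spokes y B \<union> spokes z C \<union> spokes x A = spokes x A \<union> spokes y B \<union> spokes z C"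
    by blast
  then show ?thesis
    using fin in_V asym nonempty sub centre disj missing triangle succ pred
    by unfold_locales (simp_all only: not_False_eq_True)
qed

lemma distinct_parts:
  "x \<noteq> y" "y \<noteq> z" "z \<noteq> x" "x \<notin> A" "x \<notin> B" "x \<notin> C" "y \<notin> A" "y \<notin> B" "y \<notin> C"
  "z \<notin> A" "z \<notin> B" "z \<notin> C"
  using centre disj by auto

lemma disjoint_leaves:
  "u \<in> A \<Longrightarrow> u \<notin> B \<and> u \<notin> C" "u \<in> B \<Longrightarrow> u \<notin> A \<and> u \<notin> C" "u \<in> C \<Longrightarrow> u \<notin> A \<and> u \<notin> B"
  using disj by auto

lemma K_sub: "K \<subseteq> V"
  using sub by (auto simp: K_def)

lemma adj:
  "u \<in> V \<Longrightarrow> v \<in> V \<Longrightarrow> u \<noteq> v \<Longrightarrow> E u v \<or> E v u \<or> (u \<in> A \<and> v = x) \<or> (u = x \<and> v \<in> A) \<or>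
   (u \<in> B \<and> v = y) \<or> (u = y \<and> v \<in> B) \<or> (u \<in> C \<and> v = z) \<or> (u = z \<and> v \<in> C)"
  using missing[of u v] by (auto simp: spokes_def doubleton_eq_iff)

lemma adj_parts:
  assumes "u \<in> insert x A" "v \<in> insert y B"
  shows "E u v \<or> E v u"
proof -
  have "u \<in> V" "v \<in> V" "u \<noteq> v" "v \<notin> insert x A" "u \<notin> insert y B"
    "u \<notin> insert z C" "v \<notin> insert z C"
    using assms sub disj by auto
  then show ?thesis
    using adj[of u v] by blast
qed

lemma not_adj: "a \<in> A \<Longrightarrow> \<not> E a x \<and> \<not> E x a"
  using missing[of a x] sub centre by (auto simp: spokes_def)

text \<open>Within one star the required arcs are missing edges or loops. The star of
  \<open>z\<close> is excluded by \<open>E z x\<close> and the path \<open>x\<close>,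
  \<open>y\<close>, \<open>z\<close>. For the star of \<open>y\<close>, the arc \<open>E x y\<close>
  forces leaf to be paired with leaf.\<close>

lemma loses_next:
  assumes "a \<in> A" "e \<in> spokes x A \<union> spokes y B \<union> spokes z C" "loses E {a, x} e"
  obtains b where "b \<in> B" "e = {b, y}" "E a b" "\<not> reach2 E a y" "\<not> reach2 E x b"
proof -
  consider a' where "a' \<in> A" "e = {a', x}" | b where "b \<in> B" "e = {b, y}"
    | c where "c \<in> C" "e = {c, z}"
    using assms(2) by (auto simp: spokes_def)
  then show ?thesis
  proof cases
    case 1
    then show ?thesis
      using assms not_adj by (auto simp: loses_doubleton dest: asym)
  next
    case 2
    then show ?thesis
      using assms that triangle by (auto simp: loses_doubleton reach2_def)
  next
    case 3
    have "\<not> E x z" "reach2 E x z"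
      using asym triangle distinct_parts by (auto simp: reach2_def)
    with 3 show ?thesis
      using assms by (auto simp: loses_doubleton)
  qed
qed

text \<open>For leaves \<open>a\<close> of \<open>x\<close> and \<open>b\<close> of
  \<open>y\<close>: \<open>{a, x}\<close> loses to \<open>{b, y}\<close>, the arc
  \<open>E x y\<close> being a standing hypothesis.\<close>

definition beats where "beats a b \<longleftrightarrow> E a b \<and> \<not> reach2 E a y \<and> \<not> reach2 E x b"

lemma beats_right:
  assumes "a \<in> A"
  shows "\<exists>b \<in> B. beats a b"
proof -
  have "{a, x} \<in> spokes x A \<union> spokes y B \<union> spokes z C"
    using assms by (auto simp: spokes_def)
  then obtain e where e: "e \<in> spokes x A \<union> spokes y B \<union> spokes z C" "loses E {a, x} e"
    using succ by blast
  show ?thesis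
    by (rule loses_next[OF assms e]) (auto simp: beats_def)
qed

text \<open>By the rotations of \<open>loses_next\<close>, the star of \<open>y\<close> loses only
  to that of \<open>z\<close>, and the star of \<open>z\<close> only to that of \<open>x\<close>. So
  a predecessor of \<open>{b, y}\<close> comes from the star of \<open>x\<close>.\<close>

lemma beats_left:
  assumes "b \<in> B"
  shows "\<exists>a \<in> A. beats a b"
proof -
  interpret R1: missing_stars V E y z x B C A by (rule rotate)
  interpret R2: missing_stars V E z x y C A B by (rule R1.rotate)
  have mem: "{b, y} \<in> spokes x A \<union> spokes y B \<union> spokes z C"
    using assms by (auto simp: spokes_def)
  then obtain e where e: "e \<in> spokes x A \<union> spokes y B \<union> spokes z C" "loses E e {b, y}"
    using pred by blast
  then consider a where "a \<in> A" "e = {a, x}" | b' where "b' \<in> B" "e = {b', y}"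
    | c where "c \<in> C" "e = {c, z}"
    by (auto simp: spokes_def)
  then show ?thesis
  proof cases
    case (1 a)
    obtain b' where "b' \<in> B" "{b, y} = {b', y}" "E a b'" "\<not> reach2 E a y" "\<not> reach2 E x b'"
      by (rule loses_next[OF 1(1) mem e(2)[unfolded 1(2)]])
    then show ?thesis
      using 1 by (auto simp: beats_def doubleton_eq_iff)
  next
    case (2 b')
    have "{b, y} \<in> spokes y B \<union> spokes z C \<union> spokes x A"
      using mem by blast
    then obtain c where "c \<in> C" "{b, y} = {c, z}"
      by (rule R1.loses_next[OF 2(1) _ e(2)[unfolded 2(2)]])
    then show ?thesis
      using distinct_parts by (auto simp: doubleton_eq_iff)
  next
    case (3 c)
    have "{b, y} \<in> spokes z C \<union> spokes x A \<union> spokes y B"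
      using mem by blast
    then obtain a where "a \<in> A" "{b, y} = {a, x}"
      by (rule R2.loses_next[OF 3(1) _ e(2)[unfolded 3(2)]])
    then show ?thesis
      using distinct_parts by (auto simp: doubleton_eq_iff)
  qed
qed

section \<open>Arcs inside \<open>K\<close> and out of \<open>K\<close>\<close>

text \<open>\<open>x\<close> does not reach \<open>b\<close>, and no missing edge joins different
  stars, so the arc runs from \<open>b\<close> to \<open>x\<close>.\<close>

lemma leaf_centre:
  assumes "b \<in> B"
  shows "E b x"
proof -
  obtain a where "a \<in> A" "beats a b"
    using beats_left assms by blast
  then show ?thesis
    using adj_parts[of x b] assms by (auto simp: beats_def reach2_def)
qed

lemma centre_leaf:
  assumes "a \<in> A"
  shows "E y a"
proof -
  obtain b where "b \<in> B" "beats a b"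
    using beats_right assms by blast
  then show ?thesis
    using adj_parts[of a y] assms by (auto simp: beats_def reach2_def)
qed

text \<open>An arc from \<open>t\<close> to \<open>b\<close> would complete a forbidden path from
  \<open>x\<close> to \<open>b\<close>.\<close>

lemma out_x_leaf:
  assumes "b \<in> B" "E x t" "E b t \<or> E t b" "t \<noteq> b"
  shows "E b t"
proof -
  have "\<not> reach2 E x b"
    using beats_left assms by (auto simp: beats_def)
  then show ?thesis
    using assms distinct_parts by (auto simp: reach2_def)
qed

text \<open>Dually, an arc from \<open>t\<close> to \<open>y\<close> would complete a forbidden path
  from \<open>a\<close> to \<open>y\<close>.\<close>

lemma out_leaf_y:
  assumes "a \<in> A" "E a t" "E y t \<or> E t y" "t \<noteq> y"
  shows "E y t"
proof -
  have "\<not> reach2 E a y"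
    using beats_right assms by (auto simp: beats_def)
  then show ?thesis
    using assms distinct_parts by (auto simp: reach2_def)
qed

lemma adj_outside: "u \<in> V \<Longrightarrow> t \<in> V - K \<Longrightarrow> u \<noteq> t \<Longrightarrow> E u t \<or> E t u"
  using adj[of u t] by (auto simp: K_def)

lemma out_outside:
  assumes "t \<in> V - K"
  shows "b \<in> B \<Longrightarrow> E x t \<Longrightarrow> E b t" and "a \<in> A \<Longrightarrow> E a t \<Longrightarrow> E y t"
proof -
  show "E b t" if "b \<in> B" "E x t"
    by (rule out_x_leaf) (use that assms sub adj_outside[of b t] in \<open>auto simp: K_def\<close>)
  show "E y t" if "a \<in> A" "E a t"
    by (rule out_leaf_y[of a]) (use that assms sub adj_outside[of y t] in \<open>auto simp: K_def\<close>)
qed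

text \<open>The out-neighbourhoods outside \<open>K\<close> increase along \<open>x, B, z, A, y, C, x\<close>, so all agree.\<close>

lemma module:
  assumes "u \<in> K" "v \<in> K" "t \<in> V - K" "E u t"
  shows "E v t"
proof -
  interpret R1: missing_stars V E y z x B C A by (rule rotate)
  interpret R2: missing_stars V E z x y C A B by (rule R1.rotate)
  have K: "R1.K = K" "R2.K = K"
    by (auto simp: K_def R1.K_def R2.K_def)
  note step = out_outside[OF assms(3)] R1.out_outside[unfolded K, OF assms(3)]
    R2.out_outside[unfolded K, OF assms(3)]
  obtain a b c where "a \<in> A" "b \<in> B" "c \<in> C"
    using nonempty by blast
  \<comment> \<open>Following the cycle of inclusions leads from any part of \<open>K\<close> to
    \<open>x\<close>; the steps below go round once more to cover \<open>v\<close>.\<close>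
  then have "E x t"
    using assms step unfolding K_def by (metis UnE insertE)
  then have "E b t" if "b \<in> B" for b using that step by blast
  moreover from this \<open>b \<in> B\<close> have "E z t" using step by blast
  moreover from this have "E a t" if "a \<in> A" for a using that step by blast
  moreover from this \<open>a \<in> A\<close> have "E y t" using step by blast
  moreover from this have "E c t" if "c \<in> C" for c using that step by blast
  ultimately show ?thesis
    using assms(2) \<open>E x t\<close> by (auto simp: K_def)
qed

text \<open>In \<open>K\<close>, out-neighbours of \<open>z\<close> lie in
  \<open>insert x B\<close>, and \<open>insert y C\<close> consists of second out-neighbours. The
  other vertex is an \<open>a\<close> with the property in the tournament on \<open>A\<close>:
  passing to \<open>K\<close> adds at most \<open>z\<close> and \<open>B\<close> to its first
  neighbourhood and at least \<open>x\<close> and \<open>C\<close> to its second.\<close>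

lemma two_seymour_vertices_if_card_le:
  assumes "card B \<le> card C"
  shows "\<exists>u \<in> K. \<exists>v \<in> K. u \<noteq> v \<and> seymour K E (\<lambda>_. 1) u \<and> seymour K E (\<lambda>_. 1) v"
proof -
  interpret R1: missing_stars V E y z x B C A by (rule rotate)
  interpret R2: missing_stars V E z x y C A B by (rule R1.rotate)
  have finK: "finite K"
    using K_sub fin finite_subset by blast
  then have fins: "finite A" "finite B" "finite C"
    by (auto simp: K_def)
  \<comment> \<open>As \<open>x\<close> dominates every \<open>c\<close>, \<open>out_x_leaf\<close>
    orients the arc from \<open>b\<close> to \<open>c\<close>; the next two facts are
    rotations.\<close>
  have BC: "E b c" if "b \<in> B" "c \<in> C" for b c
    by (rule out_x_leaf)
      (use that R2.centre_leaf[of c] R1.adj_parts[of b c] disjoint_leaves in blast)+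
  have CA: "E c a" if "c \<in> C" "a \<in> A" for c a
    by (rule R1.out_x_leaf)
      (use that centre_leaf[of a] R2.adj_parts[of c a] disjoint_leaves in blast)+
  have AB: "E a b" if "a \<in> A" "b \<in> B" for a b
    by (rule R2.out_x_leaf)
      (use that R1.centre_leaf[of b] adj_parts[of a b] disjoint_leaves in blast)+
  have card_insert_BC: "card (insert v B) \<le> card (insert v' C)" if "v \<notin> B" "v' \<notin> C" for v v'
    using that fins assms by simp
  have "seymour K E (\<lambda>_. 1) z"
  proof -
    have "nbrs K E z \<subseteq> insert x B"
      using R2.not_adj R2.leaf_centre triangle asym by (auto simp: nbrs_def K_def)
    then have "card (nbrs K E z) \<le> card (insert x B)"
      using fins by (intro card_mono) auto
    also have "\<dots> \<le> card (insert y C)"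
      using card_insert_BC distinct_parts by blast
    also have "\<dots> \<le> card (nbrs2 K E z)"
    proof (rule card_mono)
      show "insert y C \<subseteq> nbrs2 K E z"
        using triangle asym R2.not_adj R2.centre_leaf distinct_parts
        by (auto simp: nbrs2_def K_def)
    qed (use finK in \<open>auto simp: nbrs2_def\<close>)
    finally show ?thesis by (simp add: seymour_def)
  qed
  \<comment> \<open>Every missing edge contains a centre, so the leaves of one star are pairwise
    adjacent.\<close>
  moreover have "tournament_on A E"
    unfolding tournament_on_def
  proof (intro conjI allI impI ballI)
    show "E u v \<or> E v u" if "u \<in> A" "v \<in> A" "u \<noteq> v" for u v
      using adj[of u v] that sub distinct_parts disjoint_leaves by blast
  qed (use fins asym in auto)
  then obtain a where a: "a \<in> A" "seymour A E (\<lambda>_. 1) a"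
    using exists_seymour_vertex[of A E "\<lambda>_. 1"] nonempty by auto
  have "seymour K E (\<lambda>_. 1) a"
  proof -
    have "nbrs K E a \<subseteq> nbrs A E a \<union> insert z B"
      using not_adj[of a] centre_leaf[of a] CA a(1) asym by (auto simp: nbrs_def K_def)
    then have "card (nbrs K E a) \<le> card (nbrs A E a \<union> insert z B)"
      using fins by (intro card_mono) (auto simp: nbrs_def)
    also have "\<dots> \<le> card (nbrs A E a) + card (insert z B)"
      by (rule card_Un_le)
    also have "\<dots> \<le> card (nbrs2 A E a) + card (insert x C)"
      using a(2) card_insert_BC[of z x] distinct_parts by (intro add_mono) (auto simp: seymour_def)
    also have "\<dots> = card (nbrs2 A E a \<union> insert x C)"
    proof (rule card_Un_disjoint[symmetric])
      show "nbrs2 A E a \<inter> insert x C = {}"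
        using distinct_parts(4) disjoint_leaves(1) by (auto simp: nbrs2_def)
    qed (use fins in \<open>auto simp: nbrs2_def\<close>)
    also have "\<dots> \<le> card (nbrs2 K E a)"
    proof (rule card_mono)
      obtain b where "b \<in> B" using nonempty by blast
      then have "c \<in> nbrs2 K E a" if "c \<in> C" for c
        using that a(1) AB[of a b] BC[of b c] CA[of c a] asym distinct_parts
        by (auto simp: nbrs2_def K_def)
      moreover have "E a z"
        using R1.leaf_centre R2.leaf_centre a(1) by blast
      then have "x \<in> nbrs2 K E a"
        using triangle not_adj a(1) distinct_parts by (auto simp: nbrs2_def K_def)
      ultimately show "nbrs2 A E a \<union> insert x C \<subseteq> nbrs2 K E a"
        by (auto simp: nbrs2_def K_def)
    qed (use finK in \<open>auto simp: nbrs2_def\<close>)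
    finally show ?thesis by (simp add: seymour_def)
  qed
  ultimately show ?thesis
    using a(1) distinct_parts by (auto simp: K_def)
qed

lemma two_seymour_vertices:
  assumes "\<And>u. u \<in> V \<Longrightarrow> \<exists>v \<in> V. E u v"
  shows "\<exists>u \<in> V. \<exists>v \<in> V. u \<noteq> v \<and> seymour V E (\<lambda>_. 1) u \<and> seymour V E (\<lambda>_. 1) v"
proof -
  interpret R1: missing_stars V E y z x B C A by (rule rotate)
  interpret R2: missing_stars V E z x y C A B by (rule R1.rotate)
  have K: "R1.K = K" "R2.K = K"
    by (auto simp: K_def R1.K_def R2.K_def)
  \<comment> \<open>Otherwise the three cardinalities would decrease strictly around a
    cycle.\<close>
  have "card B \<le> card C \<or> card C \<le> card A \<or> card A \<le> card B"
    by linarith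
  then obtain u v where uv: "u \<in> K" "v \<in> K" "u \<noteq> v"
    "seymour K E (\<lambda>_. 1) u" "seymour K E (\<lambda>_. 1) v"
    using two_seymour_vertices_if_card_le R1.two_seymour_vertices_if_card_le
      R2.two_seymour_vertices_if_card_le unfolding K by blast
  show ?thesis
    by (rule two_seymour_vertices_if_module[OF fin K_sub _ _ _ _ uv])
      (use asym adj_outside module assms in blast)+
qed

end

section \<open>Translation from digraphs to relations\<close>

text \<open>The induced cycle may traverse the given centres in either sense, so both orientations
  remain.\<close>

lemma directed_triangleE:
  assumes "directed_triangle (D \<restriction> {x, y, z})"
  shows "distinct [x, y, z] \<and>
    (x \<rightarrow>\<^bsub>D\<^esub> y \<and> y \<rightarrow>\<^bsub>D\<^esub> z \<and> z \<rightarrow>\<^bsub>D\<^esub> x \<or> x \<rightarrow>\<^bsub>D\<^esub> z \<and> z \<rightarrow>\<^bsub>D\<^esub> y \<and> y \<rightarrow>\<^bsub>D\<^esub> x)"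
proof -
  obtain a b c where abc: "distinct [a, b, c]" "{x, y, z} = {a, b, c}"
    "arcs_ends (D \<restriction> {x, y, z}) = {(a, b), (b, c), (c, a)}"
    using assms by (auto simp: directed_triangle_def)
  have "arcs_ends (D \<restriction> {x, y, z}) \<subseteq> arcs_ends D"
    by (auto simp: arcs_ends_def arc_to_ends_def induce_subgraph_def)
  then have arcs: "a \<rightarrow>\<^bsub>D\<^esub> b" "b \<rightarrow>\<^bsub>D\<^esub> c" "c \<rightarrow>\<^bsub>D\<^esub> a"
    using abc(3) by auto
  have "card {x, y, z} = 3"
    using abc(1,2) by simp
  then have "x \<noteq> y" "y \<noteq> z" "x \<noteq> z"
    by (auto simp: card_insert_if split: if_splits)
  moreover have "x \<in> {a, b, c}" "y \<in> {a, b, c}" "z \<in> {a, b, c}"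
    using abc(2) by blast+
  ultimately show ?thesis
    using arcs by auto
qed

text \<open>Renaming two centres reduces the reversed triangle to the cyclic order \<open>x\<close>,
  \<open>y\<close>, \<open>z\<close>.\<close>

lemma missing_three_disjoint_stars_swap:
  "missing_three_disjoint_stars G x y z \<Longrightarrow> missing_three_disjoint_stars G x z y"
  unfolding missing_three_disjoint_stars_def
  by (elim exE, rename_tac S T U, rule_tac x = S in exI, rule_tac x = U in exI,
      rule_tac x = T in exI) (simp add: Un_ac Int_commute)

lemma loses_to_eq_loses: "loses_to G = loses (\<lambda>u v. u \<rightarrow>\<^bsub>G\<^esub> v)"
  unfolding loses_to_def loses_def reach2_def out_nbrs_def second_out_nbrs_def fun_eq_iff
  by blast

lemma two_SNP_vertices_if_cyclic:
  fixes D :: "('a, 'b) pre_digraph"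
  assumes "oriented_graph D" and stars: "missing_three_disjoint_stars D x y z"
    and tri: "x \<rightarrow>\<^bsub>D\<^esub> y" "y \<rightarrow>\<^bsub>D\<^esub> z" "z \<rightarrow>\<^bsub>D\<^esub> x"
    and no_source: "\<nexists>e. source (dependency_digraph D) e"
    and no_sink: "\<nexists>e. sink (dependency_digraph D) e"
    and D_no_sink: "\<nexists>v. sink D v"
  shows "\<exists>u \<in> verts D. \<exists>v \<in> verts D. u \<noteq> v \<and> has_SNP D u \<and> has_SNP D v"
proof -
  interpret oriented_graph D by fact
  define E where "E = (\<lambda>u v. u \<rightarrow>\<^bsub>D\<^esub> v)"
  obtain A B C where ABC: "A \<noteq> {}" "B \<noteq> {}" "C \<noteq> {}" "x \<notin> A" "y \<notin> B" "z \<notin> C"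
    "insert x A \<inter> insert y B = {}" "insert x A \<inter> insert z C = {}" "insert y B \<inter> insert z C = {}"
    and mg: "missing_graph D =
      (insert x A \<union> insert y B \<union> insert z C, spokes x A \<union> spokes y B \<union> spokes z C)"
    using stars unfolding missing_three_disjoint_stars_def star_def spokes_def by force
  have M: "missing_edges D = spokes x A \<union> spokes y B \<union> spokes z C"
    and sub: "insert x A \<union> insert y B \<union> insert z C \<subseteq> verts D"
    using mg by (auto simp: missing_graph_def)
  have in_verts: "u \<in> verts D \<and> v \<in> verts D" if "E u v" for u v
    using that by (auto simp: E_def)
  interpret missing_stars "verts D" E x y z A B C
  proof
    show "\<exists>e' \<in> spokes x A \<union> spokes y B \<union> spokes z C. loses E e e'"
      if "e \<in> spokes x A \<union> spokes y B \<union> spokes z C" for e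
    proof -
      \<comment> \<open>A missing edge is a vertex of the dependency digraph; not being a sink, it
        has an out-arc. The in-arcs below are dual.\<close>
      have "out_degree (dependency_digraph D) e \<noteq> 0"
        using no_sink that M by (auto simp: sink_def dependency_digraph_def)
      then have "out_arcs (dependency_digraph D) e \<noteq> {}"
        by (auto simp: out_degree_def)
      then show ?thesis
        unfolding M[symmetric] E_def loses_to_eq_loses[symmetric]
        by (auto simp: out_arcs_def dependency_digraph_def)
    qed
    show "\<exists>e' \<in> spokes x A \<union> spokes y B \<union> spokes z C. loses E e' e"
      if "e \<in> spokes x A \<union> spokes y B \<union> spokes z C" for e
    proof -
      have "in_degree (dependency_digraph D) e \<noteq> 0"
        using no_source that M by (auto simp: source_def dependency_digraph_def)
      then have "in_arcs (dependency_digraph D) e \<noteq> {}"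
        by (auto simp: in_degree_def)
      then show ?thesis
        unfolding M[symmetric] E_def loses_to_eq_loses[symmetric]
        by (auto simp: in_arcs_def dependency_digraph_def)
    qed
    show "\<not> E u v \<and> \<not> E v u \<longleftrightarrow> {u, v} \<in> spokes x A \<union> spokes y B \<union> spokes z C"
      if "u \<in> verts D" "v \<in> verts D" "u \<noteq> v" for u v
      using that unfolding M[symmetric]
      by (auto simp: missing_edges_def adjacent_def E_def doubleton_eq_iff)
  qed (use ABC sub in_verts tri no_digons in \<open>auto simp: E_def\<close>)
  have "\<exists>v \<in> verts D. E u v" if "u \<in> verts D" for u
  proof -
    have "out_arcs D u \<noteq> {}"
      using D_no_sink that by (auto simp: sink_def out_degree_def)
    then obtain e where "e \<in> arcs D" "tail D e = u"
      by (metis ex_in_conv in_out_arcs_conv)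
    then have "E u (head D e)"
      unfolding E_def using in_arcs_imp_in_arcs_ends by blast
    then show ?thesis
      using in_verts by blast
  qed
  then obtain u v where uv: "u \<in> verts D" "v \<in> verts D" "u \<noteq> v"
    "seymour (verts D) E (\<lambda>_. 1) u" "seymour (verts D) E (\<lambda>_. 1) v"
    using two_seymour_vertices by blast
  \<comment> \<open>Arcs have both ends in \<open>verts D\<close>, so restricting the neighbourhoods
    to that set loses nothing.\<close>
  have "has_SNP D u \<longleftrightarrow> seymour (verts D) E (\<lambda>_. 1) u" for u
  proof -
    have "out_nbrs D u = nbrs (verts D) E u" "second_out_nbrs D u = nbrs2 (verts D) E u"
      using in_verts by (auto simp: out_nbrs_def second_out_nbrs_def nbrs_def nbrs2_def E_def)
    then show ?thesis
      by (simp add: has_SNP_def seymour_def)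
  qed
  with uv show ?thesis by blast
qed

theorem theorem7:
  fixes D :: "('a, 'b) pre_digraph" and x y z :: 'a
  assumes "oriented_graph D"
    and "missing_three_disjoint_stars D x y z"
    and "directed_triangle (D \<restriction> {x, y, z})"
    and "\<nexists>e. source (dependency_digraph D) e"
    and "\<nexists>e. sink (dependency_digraph D) e"
    and "\<nexists>v. sink D v"
  shows "\<exists>u \<in> verts D. \<exists>v \<in> verts D. u \<noteq> v \<and> has_SNP D u \<and> has_SNP D v"
  using directed_triangleE[OF assms(3)] two_SNP_vertices_if_cyclic[OF assms(1,2)]
    two_SNP_vertices_if_cyclic[OF assms(1) missing_three_disjoint_stars_swap[OF assms(2)]]
    assms(4-6) by blast

end
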